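(* For every integer $d \ge 3$ there exists a constant $C_d > 0$ such that for all integers $n \ge d+1$, $$\Delta_{d+1,d}(n) \le C_d\, n^{-\log d + 6}.$$
   Context: For integers $d\ge 1$ and $n \ge d+1$, $\Delta_{d+1,d}(n)$ denotes the minimum $\Delta > 0$ such that among any $n$ (distinct) points in $[0,1]^d$ there are $d+1$ points which form a simplex with $d$-dimensional volume at most $\Delta$ (the simplex is the convex hull of the points; if it is degenerate its volume is $0$). $\log$ is the natural logarithm. *)

theory Defs
  imports "HOL-Analysis.Analysis"
begin

text \<open>The dimension \<open>d\<close> is \<open>CARD('d)\<close>, and \<open>cbox 0 1\<close> in \<open>real^'d\<close> is \<open>[0,1]\<^sup>d\<close>
  (\<open>1\<close> is the all-ones vector).\<close>

definition small_simplex_bound :: "'d::finite itself \<Rightarrow> nat \<Rightarrow> real \<Rightarrow> bool" where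
  "small_simplex_bound _ n \<Delta> \<longleftrightarrow>
     \<Delta> > 0 \<and>
     (\<forall>P :: (real^'d) set. P \<subseteq> cbox 0 1 \<and> finite P \<and> card P = n \<longrightarrow>
        (\<exists>S \<subseteq> P. card S = CARD('d) + 1 \<and> measure lebesgue (convex hull S) \<le> \<Delta>))"

definition simplex_Delta :: "'d::finite itself \<Rightarrow> nat \<Rightarrow> real" where
  "simplex_Delta T n = (LEAST \<Delta>. small_simplex_bound T n \<Delta>)"

text \<open>For \<open>n \<ge> d + 1\<close> the minimum exists (\<open>simplex_Delta_minimum\<close> below), so \<open>LEAST\<close> is
  meaningful. Positivity of the minimum rests on point sets in general position.\<close>

lemma general_position_exists:
  "\<exists>P :: (real^'d::finite) set. P \<subseteq> cbox 0 1 \<and> finite P \<and> card P = n \<and>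
     (\<forall>S \<subseteq> P. card S \<le> CARD('d) + 1 \<longrightarrow> \<not> affine_dependent S)"
proof (induction n)
  case 0
  show ?case by (intro exI[of _ "{}"]) (auto simp: affine_dependent_def)
next
  case (Suc n)
  then obtain P :: "(real^'d) set" where P: "P \<subseteq> cbox 0 1" "finite P" "card P = n"
    and ind: "\<And>S. S \<subseteq> P \<Longrightarrow> card S \<le> CARD('d) + 1 \<Longrightarrow> \<not> affine_dependent S" by blast
  define H where "H = (\<Union>T \<in> {T. T \<subseteq> P \<and> card T \<le> CARD('d)}. affine hull T)"
  have "negligible (affine hull T)" if T: "T \<subseteq> P" "card T \<le> CARD('d)" for T
  proof -
    have "interior (affine hull T) = {}"
      using T P(2) by (intro empty_interior_affine_hull) (auto intro: finite_subset)
    moreover have "closure (affine hull T) = affine hull T"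
      by (simp add: closed_affine_hull)
    ultimately have "frontier (affine hull T) = affine hull T" by (simp add: frontier_def)
    then show ?thesis
      by (metis negligible_convex_frontier affine_affine_hull affine_imp_convex)
  qed
  then have "negligible H"
    unfolding H_def using P(2) by (intro negligible_Union) auto
  moreover have "\<not> negligible (cbox 0 1 :: (real^'d) set)"
  proof -
    have "box 0 1 \<noteq> ({} :: (real^'d) set)"
      by (auto simp: interval_ne_empty_cart)
    then have "\<not> negligible (box 0 1 :: (real^'d) set)"
      by (intro open_not_negligible) auto
    then show ?thesis using box_subset_cbox negligible_subset by blast
  qed
  ultimately obtain x where x: "x \<in> cbox 0 1" "x \<notin> H" using negligible_subset by blast
  have xT: "x \<notin> affine hull T" if "T \<subseteq> P" "card T \<le> CARD('d)" for T
    using x(2) that by (auto simp: H_def)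
  have "x \<notin> P"
  proof
    assume "x \<in> P"
    then show False using xT[of "{x}"] by (simp add: Suc_le_eq)
  qed
  moreover have "\<not> affine_dependent S"
    if S: "S \<subseteq> insert x P" "card S \<le> CARD('d) + 1" for S
  proof (cases "x \<in> S")
    case False
    then show ?thesis using ind S by blast
  next
    case True
    let ?T = "S - {x}"
    have "finite S" using S(1) P(2) finite_subset by blast
    then have "card ?T \<le> CARD('d)" using S(2) True by simp
    moreover have "?T \<subseteq> P" using S(1) by auto
    ultimately have "\<not> affine_dependent (insert x ?T)"
      using ind[of ?T] xT[of ?T] by (intro affine_independent_insert) auto
    then show ?thesis using True by (simp add: insert_absorb)
  qed
  ultimately show ?case
    using P x(1) by (intro exI[of _ "insert x P"]) auto
qed

lemma simplex_volume_pos: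
  fixes S :: "(real^'d::finite) set"
  assumes "card S = CARD('d) + 1" "\<not> affine_dependent S"
  shows "measure lebesgue (convex hull S) > 0"
proof -
  have "interior (convex hull S) \<noteq> {}"
    using interior_convex_hull_eq_empty[of S] assms by simp
  then have "\<not> negligible (convex hull S)"
    using open_not_negligible[of "interior (convex hull S)"] negligible_subset interior_subset
      open_interior by blast
  moreover have "convex hull S \<in> lmeasurable"
    using assms(2) by (intro lmeasurable_compact finite_imp_compact_convex_hull)
      (rule aff_independent_finite)
  ultimately show ?thesis
    using negligible_iff_measure0 zero_less_measure_iff by (metis)
qed

lemma simplex_Delta_minimum:
  assumes n: "n \<ge> CARD('d::finite) + 1"
  shows "small_simplex_bound TYPE('d) n (simplex_Delta TYPE('d) n)"
    and "small_simplex_bound TYPE('d) n \<Delta> \<Longrightarrow> simplex_Delta TYPE('d) n \<le> \<Delta>"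
proof -
  let ?B = "small_simplex_bound TYPE('d) n"
  let ?vol = "\<lambda>S :: (real^'d) set. measure lebesgue (convex hull S)"
  let ?simps = "\<lambda>P :: (real^'d) set. {S. S \<subseteq> P \<and> card S = CARD('d) + 1}"
  define m where "m P = Min (?vol ` ?simps P)" for P
  define C where "C = {P :: (real^'d) set. P \<subseteq> cbox 0 1 \<and> finite P \<and> card P = n}"
  have fin: "finite (?vol ` ?simps P)" and ne: "?vol ` ?simps P \<noteq> {}" if "P \<in> C" for P
  proof -
    have "finite P" using that by (auto simp: C_def)
    then show "finite (?vol ` ?simps P)" by simp
    have "CARD('d) + 1 \<le> card P" using that n by (auto simp: C_def)
    then obtain S where "S \<subseteq> P" "card S = CARD('d) + 1"
      by (rule obtain_subset_with_card_n)
    then show "?vol ` ?simps P \<noteq> {}" by blast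
  qed
  have B_iff: "?B \<Delta> \<longleftrightarrow> \<Delta> > 0 \<and> (\<forall>P \<in> C. m P \<le> \<Delta>)" for \<Delta>
  proof -
    have "m P \<le> \<Delta> \<longleftrightarrow> (\<exists>S \<subseteq> P. card S = CARD('d) + 1 \<and> ?vol S \<le> \<Delta>)" if "P \<in> C" for P
      unfolding m_def Min_le_iff[OF fin[OF that] ne[OF that]] by blast
    then show ?thesis unfolding small_simplex_bound_def C_def by auto
  qed
  obtain P0 where P0: "P0 \<in> C"
    and ind: "\<And>S. S \<subseteq> P0 \<Longrightarrow> card S \<le> CARD('d) + 1 \<Longrightarrow> \<not> affine_dependent S"
    using general_position_exists[of n, where 'd = 'd] unfolding C_def by blast
  have pos: "m P0 > 0"
  proof -
    have "?vol S > 0" if "S \<in> ?simps P0" for S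
      using that ind[of S] by (intro simplex_volume_pos) auto
    then show ?thesis
      unfolding m_def Min_gr_iff[OF fin[OF P0] ne[OF P0]] by blast
  qed
  have le1: "m P \<le> measure lebesgue (cbox 0 1 :: (real^'d) set)" if P: "P \<in> C" for P
  proof -
    obtain S where S: "S \<subseteq> P" "card S = CARD('d) + 1" using ne[OF P] by blast
    have "S \<subseteq> cbox 0 1" "finite S" using S P by (auto simp: C_def intro: finite_subset)
    then have "?vol S \<le> measure lebesgue (cbox 0 1 :: (real^'d) set)"
      by (intro measure_mono_fmeasurable hull_minimal convex_box)
        (auto intro: fmeasurableD lmeasurable_compact finite_imp_compact_convex_hull)
    then show ?thesis
      unfolding m_def using S by (intro order_trans[OF Min_le[OF fin[OF P]]]) blast+
  qed
  have bdd: "bdd_above (m ` C)" using le1 by (auto intro!: bdd_aboveI)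
  let ?s = "SUP P \<in> C. m P"
  have Bs: "?B ?s"
    unfolding B_iff using pos cSUP_upper[OF P0 bdd] cSUP_upper[OF _ bdd] by force
  have min: "?s \<le> \<Delta>" if "?B \<Delta>" for \<Delta>
    using that P0 unfolding B_iff by (intro cSUP_least) auto
  have eq: "simplex_Delta TYPE('d) n = ?s"
    unfolding simplex_Delta_def using Bs min by (rule Least_equality)
  show "?B (simplex_Delta TYPE('d) n)" using Bs eq by simp
  show "?B \<Delta> \<Longrightarrow> simplex_Delta TYPE('d) n \<le> \<Delta>" using min eq by simp
qed

end

theory Submission
  imports Defs
begin

text \<open>
  Fix one of the $n$ points as the origin. The volume of a simplex with that vertex is, up to the
  factor $1/d!$, the absolute value of a $d \times d$ determinant, so it suffices to find, among
  $n$ bounded vectors in $d$ dimensions, $d$ of them with a determinant of size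
  $O(n^{-\beta(d)})$, where $\beta(d) \ge \log d - 6$. No geometry of the points is left in this
  formulation, and it can be attacked by induction on $d$.

  Cut the cube into about $n/k$ small cubes. By the pigeonhole principle some $k$ of the vectors
  lie in the same one, hence within $O(n^{-1/d})$ of each other (\<open>exists_cluster\<close>). Force these $k$
  vectors to be among the chosen ones. Subtracting one of them from the other $k-1$ does not change
  the determinant and gives $k-1$ rows of size $O(n^{-1/d})$. Gaussian elimination with complete
  pivoting removes the $k$ forced rows one at a time: each contributes its own size as a factor,
  and all other vectors at most double in size (\<open>minor_decay_eliminate\<close>). What remains is
  the same problem in dimension $d-k$ for the other $n-k$ vectors. Thus
  $$\beta(d) \ge \beta(d-k) + \frac{k-1}{d}$$
  (\<open>minor_decay_cluster\<close>).

  If one could gain $k/d$ instead of $(k-1)/d$ in the limit of small steps, the sum of the gains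
  would be $\int dx/x = \log d$. A step of length $k$ loses $1/d$ against that because of the $-1$, and
  about $k^2/d^2$ because $1/x$ is replaced by its smallest value on the interval from $d-k$ to $d$.
  Both losses are about $1/d$ when $k$ is close to $\sqrt d$, and with this $k$ the total loss
  converges: $\beta(x) = \log x - 6 + 6/\sqrt x$ satisfies the recursion for $x \ge 25$
  (\<open>exponent_step\<close>). For $1 \le x \le 25$ it is at most $0$ (\<open>exponent_nonpos\<close>), and the exponent
  $0$ is admissible in every dimension because bounded vectors have bounded determinants
  (\<open>minor_decay_0\<close>). The coefficient $6$ of $1/\sqrt x$ is what makes one step of the recursion
  work, and the constant $6$ is subtracted so that $\beta(1) = 0$.
\<close>

section \<open>Minors and elimination\<close>

text \<open>The rows and columns outside \<open>S\<close> are those of the identity matrix, so this is the minor of \<open>r\<close>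
  on the coordinates in \<open>S\<close>. The padding lets determinants of all sizes live in one matrix type,
  which makes an induction on the dimension possible.\<close>

definition minor :: "'n::finite set \<Rightarrow> ('n \<Rightarrow> real^'n) \<Rightarrow> real" where
  "minor S r = det (\<chi> i l. if i \<in> S \<and> l \<in> S then r i $ l else if i = l then 1 else 0)"

lemma det_subtract_row:
  fixes A :: "real^'n^'n::finite"
  assumes "r \<notin> T"
  shows "det (\<chi> i. if i \<in> T then A $ i - c i *\<^sub>R A $ r else A $ i) = det A"
proof -
  have "finite T" by simp
  then show ?thesis using assms
  proof (induction T rule: finite_induct)
    case empty
    have "(\<chi> i. A $ i) = A" by (simp add: vec_eq_iff)
    then show ?case by simp
  next
    case (insert t T)
    let ?M = "\<chi> i. if i \<in> T then A $ i - c i *\<^sub>R A $ r else A $ i"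
    have "(\<chi> i. if i \<in> insert t T then A $ i - c i *\<^sub>R A $ r else A $ i)
        = (\<chi> i. if i = t then row t ?M + (- c t) *s row r ?M else row i ?M)"
      using insert.hyps insert.prems by (auto simp: vec_eq_iff row_def)
    moreover have "t \<noteq> r" using insert.prems by auto
    ultimately have "det (\<chi> i. if i \<in> insert t T then A $ i - c i *\<^sub>R A $ r else A $ i) = det ?M"
      by (simp only: det_row_operation[OF \<open>t \<noteq> r\<close>])
    then show ?case using insert by simp
  qed
qed

lemma minor_cong:
  "(\<And>i l. i \<in> S \<Longrightarrow> l \<in> S \<Longrightarrow> r i $ l = r' i $ l) \<Longrightarrow> minor S r = minor S r'"
  unfolding minor_def by (rule arg_cong[where f = det]) (auto simp: vec_eq_iff)

lemma minor_UNIV: "minor UNIV r = det (\<chi> i. r i)"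
  unfolding minor_def by (rule arg_cong[where f = det]) (auto simp: vec_eq_iff)

lemma minor_subtract_row:
  fixes r :: "'n::finite \<Rightarrow> real^'n"
  assumes "j \<in> S" "c j = 0"
  shows "minor S (\<lambda>i. r i - c i *\<^sub>R r j) = minor S r"
proof -
  let ?A = "\<chi> i l. if i \<in> S \<and> l \<in> S then r i $ l else if i = l then 1 else 0"
  have "minor S (\<lambda>i. r i - c i *\<^sub>R r j)
      = det (\<chi> i. if i \<in> S - {j} then ?A $ i - c i *\<^sub>R ?A $ j else ?A $ i)"
    unfolding minor_def using assms
    by (intro arg_cong[where f = det]) (auto simp: vec_eq_iff)
  also have "\<dots> = det ?A" by (rule det_subtract_row) simp
  finally show ?thesis by (simp add: minor_def)
qed

lemma minor_zero_row:
  assumes "j \<in> S" "\<And>l. l \<in> S \<Longrightarrow> r j $ l = 0"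
  shows "minor S r = 0"
  unfolding minor_def
  by (rule det_zero_row(2)[of j]) (use assms in \<open>auto simp: row_def vec_eq_iff\<close>)

text \<open>One step of the elimination: once column \<open>j\<close> is zero off the diagonal, the row \<open>j\<close> of the full
  matrix can be split off as a right factor \<open>E\<close> that is the identity except in that row.\<close>

lemma minor_pivot:
  fixes r :: "'n::finite \<Rightarrow> real^'n"
  assumes j: "j \<in> S" and zero: "\<And>i. i \<in> S - {j} \<Longrightarrow> r i $ j = 0"
  shows "minor S r = r j $ j * minor (S - {j}) r"
proof -
  \<comment> \<open>\<open>E\<close> is written as in Cramer's rule, applied to the identity matrix, which yields its determinant.\<close>
  define A M E :: "real^'n^'n" where
    "A = (\<chi> i l. if i \<in> S \<and> l \<in> S then r i $ l else if i = l then 1 else 0)" and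
    "M = (\<chi> i l. if i \<in> S - {j} \<and> l \<in> S - {j} then r i $ l else if i = l then 1 else 0)" and
    "E = (\<chi> i. if i = j then \<Sum>i\<in>UNIV. A $ j $ i *s row i (mat 1) else row i (mat 1))"
  have E: "E $ i $ l = (if i = j then A $ j $ l else if i = l then 1 else 0)" for i l
    by (simp add: E_def row_def mat_def if_distrib[of "\<lambda>x. _ * x"] cong: if_cong)
  have "(M ** E) $ i $ l = A $ i $ l" for i l
  proof (cases "i = j")
    case True
    have "(M ** E) $ i $ l = (\<Sum>k\<in>UNIV. if k = j then E $ k $ l else 0)"
      unfolding matrix_matrix_mult_def vec_lambda_beta True
      by (intro sum.cong) (auto simp: M_def)
    then show ?thesis using True by (simp add: E)
  next
    case False
    have "(M ** E) $ i $ l = (\<Sum>k\<in>UNIV. if k = l then M $ i $ k else 0)"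
      unfolding matrix_matrix_mult_def vec_lambda_beta using False
      by (intro sum.cong) (auto simp: M_def E)
    also have "\<dots> = A $ i $ l" using False zero by (auto simp: M_def A_def)
    finally show ?thesis .
  qed
  then have "M ** E = A" by (simp add: vec_eq_iff)
  then have "det A = det M * det E" by (simp flip: det_mul)
  moreover have "det E = r j $ j"
    unfolding E_def using cramer_lemma_transpose[of j "A $ j" "mat 1"] j by (simp add: A_def)
  ultimately show ?thesis
    by (simp add: minor_def A_def M_def)
qed

lemma abs_minor_le:
  fixes r :: "'n::finite \<Rightarrow> real^'n"
  assumes "B \<ge> 1" "\<And>i l. i \<in> S \<Longrightarrow> l \<in> S \<Longrightarrow> \<bar>r i $ l\<bar> \<le> B"
  shows "\<bar>minor S r\<bar> \<le> fact CARD('n) * B ^ CARD('n)"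
proof -
  let ?A = "\<chi> i l. if i \<in> S \<and> l \<in> S then r i $ l else if i = l then 1 else 0"
  have "\<bar>det ?A\<bar> \<le> (\<Sum>p | p permutes (UNIV::'n set). \<bar>of_int (sign p) * (\<Prod>i\<in>UNIV. ?A $ i $ p i)\<bar>)"
    unfolding det_def by (rule sum_abs)
  also have "\<dots> \<le> (\<Sum>p | p permutes (UNIV::'n set). B ^ CARD('n))"
  proof (rule sum_mono)
    fix p :: "'n \<Rightarrow> 'n"
    have "\<bar>\<Prod>i\<in>UNIV. ?A $ i $ p i\<bar> \<le> (\<Prod>i\<in>(UNIV::'n set). B)"
      unfolding abs_prod using assms by (intro prod_mono) auto
    then show "\<bar>of_int (sign p) * (\<Prod>i\<in>UNIV. ?A $ i $ p i)\<bar> \<le> B ^ CARD('n)"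
      by (simp add: abs_mult sign_def)
  qed
  also have "\<dots> = fact CARD('n) * B ^ CARD('n)"
    by (simp add: card_permutations)
  finally show ?thesis by (simp add: minor_def)
qed

section \<open>Clusters of points\<close>

text \<open>The pigeonhole principle for a grid with \<open>Q\<close> cells in each of the coordinates of \<open>S\<close>, where \<open>Q\<close> is
  as large as possible under the condition that there are \<open>k\<close> times as many points as cells.\<close>

lemma exists_cluster:
  fixes v :: "'a \<Rightarrow> real^'n::finite"
  assumes I: "finite I" "k \<le> card I" and k: "1 \<le> k" and S: "S \<noteq> {}" and B: "B > 0"
    and bound: "\<And>i s. i \<in> I \<Longrightarrow> s \<in> S \<Longrightarrow> \<bar>v i $ s\<bar> \<le> B"
  shows "\<exists>J\<subseteq>I. card J = k \<and> (\<forall>i\<in>J. \<forall>j\<in>J. \<forall>s\<in>S.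
           \<bar>v i $ s - v j $ s\<bar> \<le> 6 * B * real k * real (card I) powr (- 1 / real (card S)))"
proof -
  define m where "m = card S"
  define n where "n = card I"
  define x where "x = (real n / real k) powr (1 / real m)"
  define Q where "Q = nat \<lfloor>x\<rfloor>"
  have m: "m > 0" using S by (simp add: m_def card_gt_0_iff)
  have nk: "real n / real k \<ge> 1" using I k by (simp add: n_def)
  then have x1: "x \<ge> 1" using m by (simp add: x_def ge_one_powr_ge_zero)
  then have Q1: "Q \<ge> 1" and Qx: "real Q \<le> x" and xQ: "x \<le> 2 * real Q"
  proof -
    have 1: "1 \<le> \<lfloor>x\<rfloor>" using x1 by simp
    then have "1 \<le> real_of_int \<lfloor>x\<rfloor>" by linarith
    moreover have "real Q = real_of_int \<lfloor>x\<rfloor>" using 1 by (simp add: Q_def)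
    ultimately show "Q \<ge> 1" "real Q \<le> x" "x \<le> 2 * real Q"
      using floor_correct[of x] by linarith+
  qed
  have Qm: "k * Q ^ m \<le> n"
  proof -
    have "real Q ^ m \<le> x ^ m" using Qx by (intro power_mono) auto
    also have "\<dots> = real n / real k"
      using m nk k unfolding x_def by (subst powr_power) (auto simp: divide_simps)
    finally have "real (k * Q ^ m) \<le> real n" using k by (simp add: field_simps)
    then show ?thesis by linarith
  qed
  \<comment> \<open>Width \<open>2 * B / Q\<close> would be enough for half-open cells; the larger width
    keeps the points with a coordinate equal to \<open>B\<close> inside the grid.\<close>
  define h where "h = 3 * B / real Q"
  have h: "h > 0" using B Q1 by (simp add: h_def)
  define cell where "cell i = (\<lambda>s\<in>S. nat \<lfloor>(v i $ s + B) / h\<rfloor>)" for i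
  have cell_lt: "nat \<lfloor>(v i $ s + B) / h\<rfloor> < Q" if "i \<in> I" "s \<in> S" for i s
  proof -
    have "v i $ s + B \<le> 2 * B" using bound[OF that] by linarith
    also have "\<dots> < real Q * h" using B Q1 by (simp add: h_def)
    finally have "(v i $ s + B) / h < real Q" using h by (simp add: divide_simps)
    then have "\<lfloor>(v i $ s + B) / h\<rfloor> < int Q" by (simp add: floor_less_iff)
    then show ?thesis using Q1 by linarith
  qed
  let ?cells = "S \<rightarrow>\<^sub>E {..<Q}"
  have "\<exists>y\<in>?cells. card (cell -` {y} \<inter> I) * card ?cells \<ge> card I"
  proof (rule pigeonhole_card)
    show "cell \<in> I \<rightarrow> ?cells" using cell_lt by (auto simp: cell_def PiE_def extensional_def)
    show "?cells \<noteq> {}" using Q1 by (auto simp: PiE_eq_empty_iff lessThan_empty_iff)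
  qed (use I in \<open>auto intro: finite_PiE\<close>)
  then obtain y where y: "card (cell -` {y} \<inter> I) * Q ^ m \<ge> n"
    by (auto simp: card_PiE n_def m_def)
  then have "k * Q ^ m \<le> card (cell -` {y} \<inter> I) * Q ^ m" using Qm by linarith
  then have "k \<le> card (cell -` {y} \<inter> I)" using Q1 by simp
  then obtain J where J: "J \<subseteq> cell -` {y} \<inter> I" "card J = k"
    by (rule obtain_subset_with_card_n)
  have "\<bar>v i $ s - v j $ s\<bar> \<le> 6 * B * real k * real n powr (- 1 / real m)"
    if ij: "i \<in> J" "j \<in> J" and s: "s \<in> S" for i j s
  proof -
    have "i \<in> cell -` {y}" "j \<in> cell -` {y}" using ij J by blast+
    then have "cell i s = cell j s" by simp
    then have "nat \<lfloor>(v i $ s + B) / h\<rfloor> = nat \<lfloor>(v j $ s + B) / h\<rfloor>"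
      using s by (simp add: cell_def)
    moreover have "(v i $ s + B) / h \<ge> 0" "(v j $ s + B) / h \<ge> 0"
      using bound[of i s] bound[of j s] ij J s h by (auto simp: abs_le_iff)
    ultimately have "\<bar>(v i $ s + B) / h - (v j $ s + B) / h\<bar> \<le> 1" by linarith
    then have "\<bar>(v i $ s - v j $ s) / h\<bar> \<le> 1" by (simp add: diff_divide_distrib add_divide_distrib)
    then have "\<bar>v i $ s - v j $ s\<bar> \<le> h" using h by (simp add: abs_divide)
    also have "h \<le> 6 * B / x"
      using xQ Q1 x1 B unfolding h_def by (simp add: field_simps)
    also have "\<dots> = 6 * B * real k powr (1 / real m) * real n powr (- 1 / real m)"
      using k nk by (simp add: x_def powr_divide powr_minus_divide)
    also have "\<dots> \<le> 6 * B * real k powr 1 * real n powr (- 1 / real m)"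
      using k m B by (intro mult_right_mono mult_left_mono powr_mono) auto
    finally show ?thesis using k by simp
  qed
  then show ?thesis using J unfolding m_def n_def by (intro exI[of _ J]) auto
qed

section \<open>Small minors among bounded vectors\<close>

text \<open>The vectors indexed by \<open>I\<close> are those to choose from, and those indexed by \<open>J\<close> are forced to be
  rows of the minor. The forced vectors have individual bounds \<open>b\<close> because the differences inside a
  cluster are much shorter than the vectors themselves, and this gain has to be recorded.\<close>

definition vector_system ::
  "nat \<Rightarrow> nat \<Rightarrow> real \<Rightarrow> 'n::finite set \<Rightarrow> 'a set \<Rightarrow> 'a set \<Rightarrow> ('a \<Rightarrow> real^'n) \<Rightarrow> ('a \<Rightarrow> real) \<Rightarrow> bool" where
  "vector_system k m B S I J v b \<longleftrightarrow>
     card S = m \<and> finite I \<and> finite J \<and> card J = k \<and> I \<inter> J = {} \<and> m \<le> card I + k \<and>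
     (\<forall>i\<in>I. \<forall>s\<in>S. \<bar>v i $ s\<bar> \<le> B) \<and> (\<forall>j\<in>J. \<forall>s\<in>S. \<bar>v j $ s\<bar> \<le> b j)"

definition small_minor ::
  "'n::finite set \<Rightarrow> 'a set \<Rightarrow> 'a set \<Rightarrow> ('a \<Rightarrow> real^'n) \<Rightarrow> real \<Rightarrow> bool" where
  "small_minor S I J v c \<longleftrightarrow>
     (\<exists>f. inj_on f S \<and> J \<subseteq> f ` S \<and> f ` S \<subseteq> I \<union> J \<and> \<bar>minor S (\<lambda>s. v (f s))\<bar> \<le> c)"

text \<open>For \<open>k = 0\<close> and \<open>m = CARD('n)\<close> this says that \<open>\<beta>\<close> is an admissible exponent in
  Heilbronn's problem for simplices with a vertex at the origin. The constant may depend on the bound \<open>B\<close>, which grows in the course of the elimination.\<close>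

definition minor_decay :: "('a \<times> 'n::finite) itself \<Rightarrow> nat \<Rightarrow> nat \<Rightarrow> real \<Rightarrow> bool" where
  "minor_decay _ k m \<beta> \<longleftrightarrow>
     (\<forall>B>0. \<exists>C>0. \<forall>(S :: 'n set) (I :: 'a set) J v b. vector_system k m B S I J v b \<longrightarrow>
        small_minor S I J v (C * prod b J * real (card I) powr (- \<beta>)))"

lemma minor_decayE:
  assumes "minor_decay TYPE('a \<times> 'n::finite) k m \<beta>" "B > 0"
  obtains C where "C > 0"
    "\<And>(S :: 'n set) (I :: 'a set) J v b. vector_system k m B S I J v b \<Longrightarrow>
        small_minor S I J v (C * prod b J * real (card I) powr (- \<beta>))"
  using assms unfolding minor_decay_def by blast

lemma exists_selection:
  assumes "finite S" "finite I" "finite J" "I \<inter> J = {}" "card J \<le> card S" "card S \<le> card I + card J"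
  shows "\<exists>f. inj_on f S \<and> J \<subseteq> f ` S \<and> f ` S \<subseteq> I \<union> J"
proof -
  have "card S - card J \<le> card I" using assms by simp
  then obtain I' where I': "I' \<subseteq> I" "card I' = card S - card J"
    by (rule obtain_subset_with_card_n)
  have "finite I'" using I' assms(2) finite_subset by blast
  moreover have "I' \<inter> J = {}" using I' assms(4) by auto
  ultimately have "card S = card (I' \<union> J)" using assms I' by (simp add: card_Un_disjoint)
  then obtain f where "bij_betw f S (I' \<union> J)"
    using finite_same_card_bij[of S "I' \<union> J"] assms \<open>finite I'\<close> by auto
  then show ?thesis using I' by (intro exI[of _ f]) (auto simp: bij_betw_def)
qed

lemma minor_decay_mono:
  assumes "minor_decay TYPE('a \<times> 'n::finite) 0 m \<beta>" "\<beta>' \<le> \<beta>" "1 \<le> m"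
  shows "minor_decay TYPE('a \<times> 'n) 0 m \<beta>'"
  unfolding minor_decay_def
proof (intro allI impI)
  fix B :: real assume B: "B > 0"
  obtain C where C: "C > 0" and sel: "\<And>(S :: 'n set) (I :: 'a set) J v b.
      vector_system 0 m B S I J v b \<Longrightarrow>
      small_minor S I J v (C * prod b J * real (card I) powr (- \<beta>))"
    using minor_decayE[OF assms(1) B] by blast
  have "small_minor S I J v (C * prod b J * real (card I) powr (- \<beta>'))"
    if V: "vector_system 0 m B S I J v b" for S :: "'n set" and I J :: "'a set" and v b
  proof -
    note H = V[unfolded vector_system_def]
    have "real (card I) powr (- \<beta>) \<le> real (card I) powr (- \<beta>')"
      using H assms(2,3) by (intro powr_mono) auto
    then have "C * prod b J * real (card I) powr (- \<beta>) \<le> C * prod b J * real (card I) powr (- \<beta>')"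
      using H C by (intro mult_left_mono) auto
    moreover have "small_minor S I J v (C * prod b J * real (card I) powr (- \<beta>))"
      using sel V by blast
    ultimately show ?thesis unfolding small_minor_def by (meson order_trans)
  qed
  then show "\<exists>C>0. \<forall>(S :: 'n set) (I :: 'a set) J v b. vector_system 0 m B S I J v b \<longrightarrow>
      small_minor S I J v (C * prod b J * real (card I) powr (- \<beta>'))"
    using C by blast
qed

lemma minor_decay_0:
  assumes "1 \<le> m"
  shows "minor_decay TYPE('a \<times> 'n::finite) 0 m 0"
  unfolding minor_decay_def
proof (intro allI impI)
  fix B :: real assume "B > 0"
  let ?C = "fact CARD('n) * max 1 B ^ CARD('n)"
  have "small_minor S I J v (?C * prod b J * real (card I) powr (- 0))"
    if V: "vector_system 0 m B S I J v b" for S :: "'n set" and I J :: "'a set" and v b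
  proof -
    note H = V[unfolded vector_system_def]
    obtain f where f: "inj_on f S" "J \<subseteq> f ` S" "f ` S \<subseteq> I \<union> J"
      using exists_selection[of S I J] H by auto
    have "\<bar>minor S (\<lambda>s. v (f s))\<bar> \<le> ?C"
    proof (rule abs_minor_le)
      fix s l assume sl: "s \<in> S" "l \<in> S"
      then have "f s \<in> I" using f(3) H by auto
      then have "\<bar>v (f s) $ l\<bar> \<le> B" using H sl by blast
      then show "\<bar>v (f s) $ l\<bar> \<le> max 1 B" by linarith
    qed simp
    moreover have "J = {}" "card I \<noteq> 0" using H assms by auto
    ultimately show ?thesis using f unfolding small_minor_def by (intro exI[of _ f]) auto
  qed
  moreover have "?C > 0" by simp
  ultimately show "\<exists>C>0. \<forall>(S :: 'n set) (I :: 'a set) J v b. vector_system 0 m B S I J v b \<longrightarrow>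
      small_minor S I J v (C * prod b J * real (card I) powr (- 0))"
    by blast
qed

text \<open>A forced vector \<open>v j\<close> costs one dimension and one factor \<open>b j\<close>, and the exponent is unchanged. The
  pivot is its largest coordinate \<open>p\<close>, so that the multiples of \<open>v j\<close> that clear column \<open>p\<close> change no
  coordinate of another vector by more than the size of that vector. The factor \<open>2 ^ k\<close> pays for
  doubling the bounds of the \<open>k\<close> remaining forced vectors; for the vectors to choose from, the
  hypothesis is used with \<open>2 * B\<close>.\<close>

lemma minor_decay_eliminate:
  assumes decay: "minor_decay TYPE('a \<times> 'n::finite) k m \<beta>" and "k < m"
  shows "minor_decay TYPE('a \<times> 'n) (Suc k) (Suc m) \<beta>"
  unfolding minor_decay_def
proof (intro allI impI)
  fix B :: real assume B: "B > 0"
  obtain C where C: "C > 0" and sel: "\<And>(S :: 'n set) (I :: 'a set) J v b.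
      vector_system k m (2 * B) S I J v b \<Longrightarrow>
      small_minor S I J v (C * prod b J * real (card I) powr (- \<beta>))"
    using minor_decayE[OF decay, of "2 * B"] B by (metis mult_pos_pos zero_less_numeral)
  let ?C = "2 ^ k * C"
  have "small_minor S I J v (?C * prod b J * real (card I) powr (- \<beta>))"
    if V: "vector_system (Suc k) (Suc m) B S I J v b" for S :: "'n set" and I J :: "'a set" and v b
  proof -
    note H = V[unfolded vector_system_def]
    have Sne: "S \<noteq> {}" using H by auto
    have b0: "b j \<ge> 0" if "j \<in> J" for j
    proof -
      obtain s where "s \<in> S" using Sne by blast
      then have "\<bar>v j $ s\<bar> \<le> b j" using H that by blast
      then show ?thesis by linarith
    qed
    have "J \<noteq> {}" using H by auto
    then obtain j where j: "j \<in> J" by blast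
    obtain p where p: "p \<in> S" "\<And>s. s \<in> S \<Longrightarrow> \<bar>v j $ s\<bar> \<le> \<bar>v j $ p\<bar>"
    proof -
      have "finite S" by simp
      then have "Max ((\<lambda>s. \<bar>v j $ s\<bar>) ` S) \<in> (\<lambda>s. \<bar>v j $ s\<bar>) ` S" using Sne by (intro Max_in) auto
      then obtain p where "p \<in> S" "Max ((\<lambda>s. \<bar>v j $ s\<bar>) ` S) = \<bar>v j $ p\<bar>" by auto
      moreover have "\<bar>v j $ s\<bar> \<le> Max ((\<lambda>s. \<bar>v j $ s\<bar>) ` S)" if "s \<in> S" for s
        using that by (intro Max_ge) auto
      ultimately show thesis using that by auto
    qed
    show ?thesis
    proof (cases "v j $ p = 0")
      case True
      obtain f where f: "inj_on f S" "J \<subseteq> f ` S" "f ` S \<subseteq> I \<union> J"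
        using exists_selection[of S I J] H \<open>k < m\<close> by auto
      then obtain s where s: "s \<in> S" "f s = j" using j by blast
      have "minor S (\<lambda>s. v (f s)) = 0"
        by (rule minor_zero_row[OF s(1)]) (use s p True in force)
      moreover have "0 \<le> ?C * prod b J * real (card I) powr (- \<beta>)"
        using C b0 by (intro mult_nonneg_nonneg prod_nonneg) auto
      ultimately show ?thesis using f unfolding small_minor_def by (intro exI[of _ f]) auto
    next
      case False
      define w where "w i = v i - (v i $ p / v j $ p) *\<^sub>R v j" for i
      have w: "\<bar>w i $ s\<bar> \<le> 2 * c" if "s \<in> S" "\<And>s. s \<in> S \<Longrightarrow> \<bar>v i $ s\<bar> \<le> c" for i s c
      proof -
        have "\<bar>v i $ p / v j $ p * v j $ s\<bar> = \<bar>v i $ p\<bar> * (\<bar>v j $ s\<bar> / \<bar>v j $ p\<bar>)"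
          by (simp add: abs_mult)
        also have "\<dots> \<le> \<bar>v i $ p\<bar> * 1"
          using p(2)[OF that(1)] False by (intro mult_left_mono) (auto simp: divide_simps)
        finally have "\<bar>v i $ p / v j $ p * v j $ s\<bar> \<le> \<bar>v i $ p\<bar>" by simp
        moreover have "\<bar>v i $ p\<bar> \<le> c" "\<bar>v i $ s\<bar> \<le> c" using that p(1) by auto
        moreover have "w i $ s = v i $ s - v i $ p / v j $ p * v j $ s" by (simp add: w_def)
        ultimately show ?thesis by linarith
      qed
      have w_I: "\<bar>w i $ s\<bar> \<le> 2 * B" if "i \<in> I" "s \<in> S" for i s
        using w[of s i B] that H by blast
      have w_J: "\<bar>w i $ s\<bar> \<le> 2 * b i" if "i \<in> J" "s \<in> S" for i s
        using w[of s i "b i"] that H by blast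
      have "vector_system k m (2 * B) (S - {p}) I (J - {j}) w (\<lambda>i. 2 * b i)"
        unfolding vector_system_def using H j p w_I w_J by auto
      from sel[OF this]
      obtain f where f: "inj_on f (S - {p})" "J - {j} \<subseteq> f ` (S - {p})"
        "f ` (S - {p}) \<subseteq> I \<union> (J - {j})"
        "\<bar>minor (S - {p}) (\<lambda>s. w (f s))\<bar>
             \<le> C * prod (\<lambda>i. 2 * b i) (J - {j}) * real (card I) powr (- \<beta>)"
        unfolding small_minor_def by blast
      define g where "g = f(p := j)"
      have gS: "g ` (S - {p}) = f ` (S - {p})" by (intro image_cong) (auto simp: g_def)
      then have img: "g ` S = insert j (f ` (S - {p}))"
        using p(1) by (metis fun_upd_same g_def image_insert insert_Diff)
      have jI: "j \<notin> I" using H j by auto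
      have "inj_on g (S - {p})" using f(1) by (simp add: g_def inj_on_def)
      then have inj: "inj_on g S"
        using p(1) f(3) jI gS by (subst insert_Diff[OF p(1), symmetric], subst inj_on_insert)
          (auto simp: g_def)
      let ?c = "\<lambda>s. if s = p then 0 else v (g s) $ p / v j $ p"
      have gp: "v (g p) = v j" by (simp add: g_def)
      have "minor S (\<lambda>s. v (g s)) = minor S (\<lambda>s. v (g s) - ?c s *\<^sub>R v (g p))"
        by (rule minor_subtract_row[symmetric]) (use p in auto)
      also have "\<dots> = v j $ p * minor (S - {p}) (\<lambda>s. v (g s) - ?c s *\<^sub>R v (g p))"
        by (subst minor_pivot[OF p(1)]) (use False in \<open>auto simp: gp\<close>)
      also have "minor (S - {p}) (\<lambda>s. v (g s) - ?c s *\<^sub>R v (g p)) = minor (S - {p}) (\<lambda>s. w (f s))"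
        by (rule minor_cong) (auto simp: g_def w_def)
      finally have "\<bar>minor S (\<lambda>s. v (g s))\<bar> = \<bar>v j $ p\<bar> * \<bar>minor (S - {p}) (\<lambda>s. w (f s))\<bar>"
        by (simp add: abs_mult)
      also have "\<dots> \<le> b j * (C * prod (\<lambda>i. 2 * b i) (J - {j}) * real (card I) powr (- \<beta>))"
        using f(4) H j p(1) b0[OF j] by (intro mult_mono) auto
      also have "\<dots> = ?C * prod b J * real (card I) powr (- \<beta>)"
        using H j by (simp add: prod.distrib prod.remove[of J j])
      finally show ?thesis
        using inj img f(2,3) j unfolding small_minor_def by (intro exI[of _ g]) auto
    qed
  qed
  moreover have "?C > 0" using C by simp
  ultimately show "\<exists>C>0. \<forall>(S :: 'n set) (I :: 'a set) J v b. vector_system (Suc k) (Suc m) B S I J v b \<longrightarrow>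
      small_minor S I J v (C * prod b J * real (card I) powr (- \<beta>))"
    by blast
qed

lemma minor_decay_eliminate_many:
  assumes "minor_decay TYPE('a \<times> 'n::finite) 0 m \<beta>" "1 \<le> m"
  shows "minor_decay TYPE('a \<times> 'n) k (m + k) \<beta>"
proof (induction k)
  case 0
  then show ?case using assms by simp
next
  case (Suc k)
  then show ?case using minor_decay_eliminate[of k "m + k" \<beta>] assms(2) by simp
qed

text \<open>A cluster of \<open>k\<close> vectors is forced into the minor, and one of them is subtracted from the others.
  The subtracted row only has the trivial bound \<open>B\<close>, and the other \<open>k - 1\<close> rows each gain a
  factor of order \<open>card I powr (- 1 / m)\<close>.\<close>

lemma minor_decay_cluster:
  assumes decay: "minor_decay TYPE('a \<times> 'n::finite) k m \<beta>"
    and k: "1 \<le> k" "k < m" and \<beta>: "\<beta> \<ge> 0"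
  shows "minor_decay TYPE('a \<times> 'n) 0 m (\<beta> + (real k - 1) / real m)"
  unfolding minor_decay_def
proof (intro allI impI)
  fix B :: real assume B: "B > 0"
  obtain C where C: "C > 0" and sel: "\<And>(S :: 'n set) (I :: 'a set) J v b.
      vector_system k m B S I J v b \<Longrightarrow>
      small_minor S I J v (C * prod b J * real (card I) powr (- \<beta>))"
    using minor_decayE[OF decay B] by blast
  define D where "D = 6 * B * real k"
  have D: "D > 0" using B k by (simp add: D_def)
  let ?C = "C * B * D ^ (k - 1) * real (k + 1) powr \<beta>"
  have "small_minor S I J v (?C * prod b J * real (card I) powr (- (\<beta> + (real k - 1) / real m)))"
    if V: "vector_system 0 m B S I J v b" for S :: "'n set" and I J :: "'a set" and v b
  proof -
    note H = V[unfolded vector_system_def]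
    define n where "n = card I"
    have J0: "J = {}" and Sne: "S \<noteq> {}" and n: "m \<le> n" using H k by (auto simp: n_def)
    define \<delta> where "\<delta> = D * real n powr (- 1 / real m)"
    obtain K where K: "K \<subseteq> I" "card K = k"
      and near: "\<And>i j s. i \<in> K \<Longrightarrow> j \<in> K \<Longrightarrow> s \<in> S \<Longrightarrow> \<bar>v i $ s - v j $ s\<bar> \<le> \<delta>"
    proof -
      have "\<exists>K\<subseteq>I. card K = k \<and> (\<forall>i\<in>K. \<forall>j\<in>K. \<forall>s\<in>S. \<bar>v i $ s - v j $ s\<bar> \<le> \<delta>)"
        using exists_cluster[of I k S B v] H k n Sne B unfolding \<delta>_def D_def n_def by auto
      then show thesis using that by blast
    qed
    have finK: "finite K" using K(1) H finite_subset by blast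
    have "K \<noteq> {}" using K k by auto
    then obtain j where j: "j \<in> K" by blast
    define w where "w i = v i - (if i \<in> K - {j} then 1 else 0) *\<^sub>R v j" for i
    define c where "c i = (if i = j then B else \<delta>)" for i
    have cardIK: "card (I - K) = n - k"
      using K H finK by (simp add: card_Diff_subset n_def)
    have w_I: "\<bar>w i $ s\<bar> \<le> B" if "i \<in> I - K" "s \<in> S" for i s
      using that H by (auto simp: w_def)
    have w_K: "\<bar>w i $ s\<bar> \<le> c i" if "i \<in> K" "s \<in> S" for i s
      using that H near[of i j s] j K(1) by (cases "i = j") (auto simp: w_def c_def)
    have "vector_system k m B S (I - K) K w c"
      unfolding vector_system_def using H finK n k K(2) cardIK w_I w_K by auto
    from sel[OF this]
    obtain f where f: "inj_on f S" "K \<subseteq> f ` S" "f ` S \<subseteq> (I - K) \<union> K"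
      "\<bar>minor S (\<lambda>s. w (f s))\<bar> \<le> C * prod c K * real (card (I - K)) powr (- \<beta>)"
      unfolding small_minor_def by blast
    obtain p where p: "p \<in> S" "f p = j" using f(2) j by blast
    have "minor S (\<lambda>s. w (f s)) = minor S (\<lambda>s. v (f s))"
      using minor_subtract_row[of p S "\<lambda>s. if f s \<in> K - {j} then 1 else 0" "\<lambda>s. v (f s)"] p
      by (simp add: w_def)
    then have "\<bar>minor S (\<lambda>s. v (f s))\<bar> \<le> C * prod c K * real (card (I - K)) powr (- \<beta>)"
      using f(4) by simp
    also have "prod c K = B * \<delta> ^ (k - 1)"
    proof -
      have "prod c (K - {j}) = (\<Prod>i\<in>K - {j}. \<delta>)" by (intro prod.cong) (auto simp: c_def)
      then show ?thesis
        using prod.remove[OF finK j, of c] K(2) finK j by (simp add: c_def)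
    qed
    also have "\<delta> ^ (k - 1) = D ^ (k - 1) * real n powr (- ((real k - 1) / real m))"
    proof -
      have "(real n powr (- 1 / real m)) ^ (k - 1) = real n powr (- 1 / real m * real (k - 1))"
        using n k by (subst powr_power) auto
      also have "- 1 / real m * real (k - 1) = - ((real k - 1) / real m)"
        using k by (simp add: of_nat_diff field_simps)
      finally show ?thesis by (simp add: \<delta>_def power_mult_distrib)
    qed
    \<comment> \<open>Removing the cluster leaves at least the fraction \<open>1 / (k + 1)\<close> of the vectors, as \<open>k < m \<le> n\<close>.\<close>
    also have "real (card (I - K)) powr (- \<beta>) \<le> real (k + 1) powr \<beta> * real n powr (- \<beta>)"
    proof -
      have "n * 1 \<le> (k + 1) * (n - k)"
      proof -
        obtain t where "n = k + 1 + t" using n k by (metis add.commute le_Suc_ex less_le_trans Suc_eq_plus1 Suc_leI)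
        then show ?thesis by (simp add: algebra_simps)
      qed
      then have "real n \<le> real (k + 1) * real (n - k)" by (metis mult.right_neutral of_nat_le_iff of_nat_mult)
      then have "real n / real (k + 1) \<le> real (n - k)" by (simp add: divide_le_eq mult.commute)
      moreover have "real n / real (k + 1) > 0" using n k by auto
      ultimately have "real (n - k) powr (- \<beta>) \<le> (real n / real (k + 1)) powr (- \<beta>)"
        using \<beta> by (intro powr_mono2') auto
      also have "\<dots> = real (k + 1) powr \<beta> * real n powr (- \<beta>)"
        by (simp add: powr_divide powr_minus field_simps)
      finally show ?thesis by (simp add: cardIK)
    qed
    finally have "\<bar>minor S (\<lambda>s. v (f s))\<bar> \<le>
        C * (B * (D ^ (k - 1) * real n powr (- ((real k - 1) / real m)))) *
        (real (k + 1) powr \<beta> * real n powr (- \<beta>))"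
      using C B D by (simp add: mult_left_mono)
    also have "\<dots> = ?C * (real n powr (- \<beta>) * real n powr (- ((real k - 1) / real m)))"
      by (simp only: mult_ac)
    also have "\<dots> = ?C * prod b J * real n powr (- (\<beta> + (real k - 1) / real m))"
      using J0 by (simp add: powr_add[symmetric])
    finally show ?thesis
      using f J0 K(1) unfolding n_def small_minor_def by (intro exI[of _ f]) auto
  qed
  moreover have "?C > 0" using C B D by simp
  ultimately show "\<exists>C>0. \<forall>(S :: 'n set) (I :: 'a set) J v b. vector_system 0 m B S I J v b \<longrightarrow>
      small_minor S I J v (C * prod b J * real (card I) powr (- (\<beta> + (real k - 1) / real m)))"
    by blast
qed

section \<open>The exponent\<close>

text \<open>The term \<open>6 / sqrt x\<close> bounds the total loss of all steps taken in dimensions above \<open>x\<close>, which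
  turns a bound on the loss of the whole recursion into a statement that can be proved by induction.\<close>

definition exponent :: "real \<Rightarrow> real" where
  "exponent x = ln x - 6 + 6 / sqrt x"

lemma exponent_nonpos:
  assumes "1 \<le> x" "x \<le> 25"
  shows "exponent x \<le> 0"
proof -
  define s where "s = sqrt x"
  have s: "1 \<le> s" "s \<le> 5" using assms real_sqrt_le_mono[of x 25] by (simp_all add: s_def)
  have x: "ln x = 2 * ln s" using assms by (simp add: s_def ln_sqrt)
  have "ln s \<le> 3 - 3 / s"
  proof (cases "s \<le> 3")
    case True
    have "(s - 1) * s \<le> (s - 1) * 3" using s True by (intro mult_left_mono) auto
    then have "s - 1 \<le> 3 - 3 / s" using s by (simp add: field_simps)
    moreover have "ln s \<le> s - 1" using s by (intro ln_le_minus_one) auto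
    ultimately show ?thesis by linarith
  next
    case False
    have "(5::real) \<le> exp 1 * exp 1"
    proof -
      have "(5::real) \<le> 2.5 * 2.5" by simp
      also have "\<dots> \<le> exp 1 * exp 1"
        using exp_lower_Taylor_quadratic[of 1] by (intro mult_mono) auto
      finally show ?thesis .
    qed
    then have "s \<le> exp 2" using s by (simp flip: exp_add)
    then have "ln s \<le> 2" using s ln_le_cancel_iff[of s "exp 2"] by simp
    moreover have "3 / s \<le> 1" using False by simp
    ultimately show ?thesis by linarith
  qed
  then show ?thesis unfolding exponent_def x s_def[symmetric] by linarith
qed

text \<open>By concavity of the logarithm, \<open>ln x - ln (x - k)\<close> is at most \<open>k / (x - k)\<close>, and this is at most
  \<open>(k + 2) / x\<close> because \<open>k \<le> sqrt x + 1\<close> and \<open>x \<ge> 25\<close>. The last bound exceeds the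
  gain \<open>(k - 1) / x\<close> by \<open>3 / x\<close>, which is at most \<open>6 / sqrt (x - k) - 6 / sqrt x\<close>, since
  \<open>k \<ge> sqrt x\<close> and the derivative of \<open>6 / sqrt x\<close> is \<open>- 3 / (x * sqrt x)\<close>.\<close>

lemma exponent_step:
  assumes x: "25 \<le> x" and k: "sqrt x \<le> k" "k \<le> sqrt x + 1"
  shows "exponent x \<le> exponent (x - k) + (k - 1) / x"
proof -
  define s t where "s = sqrt x" and "t = sqrt (x - k)"
  have s: "5 \<le> s" using real_sqrt_le_mono[OF x] by (simp add: s_def)
  have sk: "s \<le> k" "k \<le> s + 1" using k by (simp_all add: s_def)
  have xs: "x = s * s" using x by (simp add: s_def)
  have ss: "5 * s \<le> s * s" using s by (intro mult_right_mono) auto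
  then have kx: "0 < k" "k < x" using sk s ss unfolding xs by linarith+
  have t: "0 < t" "t \<le> s" "x - k = t * t" using kx by (simp_all add: s_def t_def)
  have "ln x - ln (x - k) = ln (x / (x - k))" using kx by (simp add: ln_div)
  also have "\<dots> \<le> x / (x - k) - 1" using kx by (intro ln_le_minus_one) auto
  also have "\<dots> = k / (x - k)" using kx by (simp add: field_simps)
  also have "\<dots> \<le> (k + 2) / x"
  proof -
    have "(k + 1) * (k + 1) \<le> (s + 2) * (s + 2)"
      using sk kx by (intro mult_mono) auto
    also have "\<dots> \<le> 2 * x + 1" using ss s unfolding xs by (simp add: algebra_simps, linarith)
    finally have "k * x \<le> (k + 2) * (x - k)" by (simp add: algebra_simps)
    then show ?thesis using kx by (simp add: divide_simps)
  qed
  finally have ln: "ln x - ln (x - k) \<le> (k + 2) / x" .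
  have "3 / x \<le> 6 / t - 6 / s"
  proof -
    have "t * (s + t) \<le> s * (s + s)" using t by (intro mult_mono) auto
    then have "s * (t * (s + t)) \<le> s * (s * (s + s))" using s by (intro mult_left_mono) auto
    also have "\<dots> \<le> k * (2 * x)"
      using sk s unfolding xs by (simp add: mult_ac mult_left_mono)
    also have "k = (s - t) * (s + t)" using t(3) unfolding xs by (simp add: algebra_simps)
    finally have "(s * t) * (s + t) \<le> ((s - t) * (2 * x)) * (s + t)"
      by (simp only: mult_ac)
    then have "s * t \<le> (s - t) * (2 * x)" using s t by (simp only: mult_le_cancel_right_pos add_pos_pos)
    then have "3 * (s * t) \<le> 6 * (s - t) * x" by linarith
    then have "3 / x \<le> 6 * (s - t) / (s * t)" using s t x by (simp add: divide_simps)
    also have "\<dots> = 6 / t - 6 / s" using s t by (simp add: field_simps)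
    finally show ?thesis .
  qed
  moreover have "(k + 2) / x - 3 / x = (k - 1) / x" by (simp add: diff_divide_distrib add_divide_distrib)
  ultimately show ?thesis
    using ln unfolding exponent_def s_def[symmetric] t_def[symmetric] by linarith
qed

text \<open>The maximum with \<open>0\<close> covers the dimensions in which \<open>exponent\<close> is negative, where bounded vectors
  have bounded determinants, and it provides the nonnegative exponent that \<open>minor_decay_cluster\<close>
  asks for.\<close>

lemma minor_decay_exponent:
  assumes "1 \<le> m"
  shows "minor_decay TYPE('a \<times> 'n::finite) 0 m (max 0 (exponent (real m)))"
  using assms
proof (induction m rule: less_induct)
  case (less m)
  show ?case
  proof (cases "m < 25")
    case True
    then have "max 0 (exponent (real m)) = 0" using less.prems exponent_nonpos[of "real m"] by simp
    then show ?thesis using minor_decay_0[OF less.prems] by simp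
  next
    case False
    define k where "k = nat \<lceil>sqrt (real m)\<rceil>"
    have s: "5 \<le> sqrt (real m)" using False real_sqrt_le_mono[of 25 "real m"] by simp
    have k: "sqrt (real m) \<le> real k" "real k \<le> sqrt (real m) + 1" "1 \<le> k"
      using s unfolding k_def by linarith+
    have "5 * sqrt (real m) \<le> sqrt (real m) * sqrt (real m)" using s by (intro mult_right_mono) auto
    then have km: "k < m" using k s by simp
    let ?\<beta> = "max 0 (exponent (real (m - k)))"
    have "minor_decay TYPE('a \<times> 'n) 0 (m - k) ?\<beta>"
      using less.IH[of "m - k"] km k(3) by simp
    then have "minor_decay TYPE('a \<times> 'n) k (m - k + k) ?\<beta>"
      by (rule minor_decay_eliminate_many) (use km in simp)
    then have "minor_decay TYPE('a \<times> 'n) k m ?\<beta>" using km by simp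
    then have "minor_decay TYPE('a \<times> 'n) 0 m (?\<beta> + (real k - 1) / real m)"
      by (rule minor_decay_cluster) (use k(3) km in auto)
    moreover have "max 0 (exponent (real m)) \<le> ?\<beta> + (real k - 1) / real m"
    proof -
      have "exponent (real m) \<le> exponent (real m - real k) + (real k - 1) / real m"
        using False k by (intro exponent_step) auto
      moreover have "0 \<le> (real k - 1) / real m" using k(3) by simp
      ultimately show ?thesis using km by (simp add: of_nat_diff)
    qed
    ultimately show ?thesis using less.prems by (rule minor_decay_mono)
  qed
qed

section \<open>From determinants to simplices\<close>

lemma simplex_volume_minor:
  fixes f :: "'n \<Rightarrow> real^'n::{finite,wellorder}"
  assumes "inj f" "p \<notin> range f"
  shows "measure lebesgue (convex hull (insert p (range f)))
           = \<bar>minor UNIV (\<lambda>i. f i - p)\<bar> / fact CARD('n)"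
proof -
  have "card (insert p (range f)) = Suc CARD('n)"
    using assms by (simp add: card_image)
  moreover have "bij_betw f UNIV (insert p (range f) - {p})"
    using assms by (auto simp: bij_betw_def)
  ultimately have "measure lborel (convex hull (insert p (range f)))
      = \<bar>det (\<chi> i. \<chi> j. f j $ i - p $ i)\<bar> / fact CARD('n)"
    by (intro content_simplex) auto
  also have "(\<chi> i. \<chi> j. f j $ i - p $ i) = transpose (\<chi> i. f i - p)"
    by (simp add: transpose_def vec_eq_iff)
  also have "det \<dots> = minor UNIV (\<lambda>i. f i - p)"
    by (simp only: det_transpose minor_UNIV)
  moreover have "convex hull (insert p (range f)) \<in> sets lborel"
    using finite_imp_compact_convex_hull[of "insert p (range f)"] by (simp add: compact_imp_closed)
  ultimately show ?thesis by simp
qed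

text \<open>All simplices considered have a common vertex \<open>p\<close>, chosen arbitrarily. Its removal leaves \<open>n - 1\<close>
  points, which costs a factor \<open>2 powr \<beta>\<close>.\<close>

lemma small_simplices:
  "\<exists>C>0. \<forall>n\<ge>CARD('w::{finite,wellorder}) + 1.
     small_simplex_bound TYPE('w) n (C * real n powr (- ln (real CARD('w)) + 6))"
proof -
  define d where "d = CARD('w)"
  define \<beta> where "\<beta> = max 0 (exponent (real d))"
  have d: "1 \<le> d" by (simp add: d_def Suc_le_eq)
  have \<beta>: "\<beta> \<ge> 0" "\<beta> \<ge> ln (real d) - 6"
    using d by (auto simp: \<beta>_def exponent_def le_max_iff_disj)
  have "minor_decay TYPE((real, 'w) vec \<times> 'w) 0 d \<beta>"
    unfolding \<beta>_def by (rule minor_decay_exponent[OF d])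
  from minor_decayE[OF this zero_less_one]
  obtain C where C: "C > 0" and sel: "\<And>(S :: 'w set) (I :: (real^('w::_)) set) J v b.
      vector_system 0 d 1 S I J v b \<Longrightarrow>
      small_minor S I J v (C * prod b J * real (card I) powr (- \<beta>))"
    by blast
  have "small_simplex_bound TYPE('w) n (C * 2 powr \<beta> * real n powr (- ln (real d) + 6))"
    if n: "n \<ge> d + 1" for n
    unfolding small_simplex_bound_def
  proof (intro conjI allI impI)
    show "C * 2 powr \<beta> * real n powr (- ln (real d) + 6) > 0" using C n by simp
    fix P :: "(real^('w::_)) set" assume P: "P \<subseteq> cbox 0 1 \<and> finite P \<and> card P = n"
    then have "P \<noteq> {}" using n by auto
    then obtain p where p: "p \<in> P" by blast
    have card: "card (P - {p}) = n - 1" using P p by simp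
    have "\<bar>(x - p) $ s\<bar> \<le> 1" if "x \<in> P" for x s
    proof -
      have "x \<in> cbox 0 1" "p \<in> cbox 0 1" using P p that by auto
      then have "0 \<le> x $ s" "x $ s \<le> 1" "0 \<le> p $ s" "p $ s \<le> 1" by (simp_all add: mem_box_cart)
      then show ?thesis by simp
    qed
    then have "vector_system 0 d 1 (UNIV :: 'w set) (P - {p}) {} (\<lambda>x. x - p) (\<lambda>_. 0)"
      unfolding vector_system_def using P p n card by (auto simp: d_def)
    from sel[OF this] obtain f where f: "inj f" "range f \<subseteq> P - {p}"
      and small: "\<bar>minor UNIV (\<lambda>i. f i - p)\<bar> \<le> C * real (n - 1) powr (- \<beta>)"
      unfolding small_minor_def card by auto
    have "measure lebesgue (convex hull (insert p (range f)))
        = \<bar>minor UNIV (\<lambda>i. f i - p)\<bar> / fact CARD('w)"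
      using f by (intro simplex_volume_minor) auto
    also have "\<dots> \<le> \<bar>minor UNIV (\<lambda>i. f i - p)\<bar> / 1"
      by (intro divide_left_mono) (auto simp: fact_ge_1)
    also have "\<dots> \<le> C * real (n - 1) powr (- \<beta>)" using small by simp
    also have "\<dots> \<le> C * (2 powr \<beta> * real n powr (- ln (real d) + 6))"
    proof (rule mult_left_mono)
      have "real (n - 1) powr (- \<beta>) \<le> (real n / 2) powr (- \<beta>)"
        using \<beta> n d by (intro powr_mono2') (auto simp: of_nat_diff)
      also have "\<dots> = 2 powr \<beta> * real n powr (- \<beta>)"
        by (simp add: powr_divide powr_minus inverse_eq_divide)
      also have "\<dots> \<le> 2 powr \<beta> * real n powr (- ln (real d) + 6)"
        using \<beta> n by (intro mult_left_mono powr_mono) auto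
      finally show "real (n - 1) powr (- \<beta>) \<le> 2 powr \<beta> * real n powr (- ln (real d) + 6)" .
    qed (use C in simp)
    finally have "measure lebesgue (convex hull (insert p (range f)))
        \<le> C * 2 powr \<beta> * real n powr (- ln (real d) + 6)"
      by (simp only: mult.assoc)
    moreover have "insert p (range f) \<subseteq> P" using f p by auto
    moreover have "card (insert p (range f)) = CARD('w) + 1"
      using f by (subst card_insert_disjoint) (auto simp: card_image)
    ultimately show "\<exists>S\<subseteq>P. card S = CARD('w) + 1 \<and>
        measure lebesgue (convex hull S) \<le> C * 2 powr \<beta> * real n powr (- ln (real d) + 6)"
      by blast
  qed
  moreover have "C * 2 powr \<beta> > 0" using C by simp
  ultimately show ?thesis
    unfolding d_def by (intro exI[of _ "C * 2 powr \<beta>"] conjI allI impI)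
qed

section \<open>Arbitrary finite index types\<close>

text \<open>The volume of a simplex as a determinant (\<open>content_simplex\<close>) concerns coordinates indexed by a
  well-ordered type. An arbitrary finite index type has no chosen order, so its elements are copied
  into a type that carries one, and the problem is moved along the renaming of coordinates.\<close>

typedef 'a ordered_copy = "UNIV :: 'a set" by simp

lemma bij_Rep_ordered_copy: "bij (Rep_ordered_copy :: 'a ordered_copy \<Rightarrow> 'a)"
  by (metis Abs_ordered_copy_inverse Rep_ordered_copy_inverse UNIV_I bijI')

instance ordered_copy :: (finite) finite
  using finite_imageD[of "Rep_ordered_copy :: 'a ordered_copy \<Rightarrow> 'a" UNIV] bij_Rep_ordered_copy
  by intro_classes (auto simp: bij_def)

instantiation ordered_copy :: (finite) linorder
begin

definition less_eq_ordered_copy :: "'a ordered_copy \<Rightarrow> 'a ordered_copy \<Rightarrow> bool" where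
  "x \<le> y \<longleftrightarrow> to_nat (Rep_ordered_copy x) \<le> to_nat (Rep_ordered_copy y)"

definition less_ordered_copy :: "'a ordered_copy \<Rightarrow> 'a ordered_copy \<Rightarrow> bool" where
  "x < y \<longleftrightarrow> to_nat (Rep_ordered_copy x) < to_nat (Rep_ordered_copy y)"

instance
  by intro_classes
    (auto simp: less_ordered_copy_def less_eq_ordered_copy_def Rep_ordered_copy_inject)

end

instance ordered_copy :: (finite) wellorder
proof -
  have "{(x, y). x < y} = inv_image less_than (\<lambda>x :: 'a ordered_copy. to_nat (Rep_ordered_copy x))"
    by (auto simp: less_ordered_copy_def inv_image_def)
  then have "wf {(x, y). x < (y :: 'a ordered_copy)}" by simp
  then show "OFCLASS('a ordered_copy, wellorder_class)"
    by (rule wf_wellorderI) intro_classes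
qed

lemma CARD_ordered_copy: "CARD('a ordered_copy) = CARD('a)"
  using bij_betw_same_card[OF bij_Rep_ordered_copy] .

definition reindex :: "real^'a ordered_copy \<Rightarrow> real^'a::finite" where
  "reindex x = (\<chi> i. x $ Abs_ordered_copy i)"

lemma reindex_nth: "reindex x $ Rep_ordered_copy i = x $ i"
  by (simp add: reindex_def Rep_ordered_copy_inverse)

lemma linear_reindex: "linear reindex"
  by (rule linearI) (auto simp: reindex_def vec_eq_iff)

lemma inj_reindex: "inj reindex"
  by (rule injI) (metis reindex_nth vec_eq_iff)

lemma surj_reindex: "surj reindex"
proof (rule surjI)
  fix y :: "real^'a"
  show "reindex (\<chi> i. y $ Rep_ordered_copy i) = y"
    by (simp add: reindex_def vec_eq_iff Abs_ordered_copy_inverse)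
qed

lemma all_Rep_ordered_copy: "(\<forall>i. P (Rep_ordered_copy i)) \<longleftrightarrow> (\<forall>i. P i)"
  by (metis Abs_ordered_copy_inverse UNIV_I)

text \<open>Lebesgue measure is determined by its values on boxes, and renaming the coordinates maps boxes to
  boxes with the same side lengths.\<close>

lemma lborel_reindex:
  "(lborel :: (real^'a::finite) measure) = distr lborel borel reindex"
proof (rule lborel_eqI)
  fix l u :: "real^'a"
  assume le: "\<And>b. b \<in> Basis \<Longrightarrow> l \<bullet> b \<le> u \<bullet> b"
  define l' u' :: "real^'a ordered_copy" where "l' = (\<chi> i. l $ Rep_ordered_copy i)"
    and "u' = (\<chi> i. u $ Rep_ordered_copy i)"
  have le': "l $ i \<le> u $ i" for i
    using le[of "axis i 1"] by (simp add: inner_axis axis_in_Basis_iff)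
  have prod_Basis: "(\<Prod>b\<in>Basis. x \<bullet> b) = (\<Prod>i\<in>UNIV. x $ i)" for x :: "real^'b::finite"
    unfolding Basis_vec_def
    by (simp add: UNION_singleton_eq_range prod.reindex inj_on_def axis_eq_axis inner_axis)
  have "reindex x \<in> box l u \<longleftrightarrow> x \<in> box l' u'" for x
    using all_Rep_ordered_copy[of "\<lambda>i. l $ i < reindex x $ i \<and> reindex x $ i < u $ i"]
    by (simp add: mem_box_cart reindex_nth l'_def u'_def)
  then have "reindex -` box l u = box l' u'" by auto
  then have "emeasure (distr lborel borel reindex) (box l u) = emeasure lborel (box l' u')"
    using linear_reindex
    by (subst emeasure_distr) (auto intro!: borel_measurable_continuous_onI linear_continuous_on
        simp: linear_conv_bounded_linear)
  also have "\<dots> = (\<Prod>b\<in>Basis. (u' - l') \<bullet> b)"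
    using le' by (intro emeasure_lborel_box) (auto simp: Basis_vec_def inner_axis l'_def u'_def)
  also have "\<dots> = (\<Prod>b\<in>Basis. (u - l) \<bullet> b)"
    unfolding prod_Basis l'_def u'_def using prod.reindex_bij_betw[OF bij_Rep_ordered_copy, of "\<lambda>i. u $ i - l $ i"]
    by simp
  finally show "emeasure (distr lborel borel reindex) (box l u) = (\<Prod>b\<in>Basis. (u - l) \<bullet> b)" .
qed simp

lemma measure_reindex_hull:
  fixes T :: "(real^'a::finite ordered_copy) set"
  assumes "finite T"
  shows "measure lebesgue (convex hull (reindex ` T)) = measure lebesgue (convex hull T)"
proof -
  have meas: "X \<in> sets borel" if "compact X" for X :: "'c::euclidean_space set"
    by (rule borel_closed, rule compact_imp_closed, rule that)
  have hull: "convex hull (reindex ` T) = reindex ` (convex hull T)"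
    by (rule convex_hull_linear_image[OF linear_reindex, symmetric])
  have c: "compact (convex hull T)" "compact (convex hull (reindex ` T))"
    using assms by (auto intro!: finite_imp_compact_convex_hull)
  have "measure lborel (convex hull (reindex ` T))
      = measure (distr lborel borel reindex) (convex hull (reindex ` T))"
    by (simp flip: lborel_reindex)
  also have "\<dots> = measure lborel (reindex -` (convex hull (reindex ` T)))"
    using linear_reindex meas[OF c(2)]
    by (subst measure_distr) (auto intro!: borel_measurable_continuous_onI linear_continuous_on
        simp: linear_conv_bounded_linear)
  also have "\<dots> = measure lborel (convex hull T)"
    unfolding hull by (simp add: inj_vimage_image_eq[OF inj_reindex])
  finally show ?thesis using meas[OF c(1)] meas[OF c(2)] by simp
qed

lemma small_simplex_bound_ordered_copy:
  assumes "small_simplex_bound TYPE('d::finite ordered_copy) n \<Delta>"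
  shows "small_simplex_bound TYPE('d) n \<Delta>"
  unfolding small_simplex_bound_def
proof (intro conjI allI impI)
  show "\<Delta> > 0" using assms by (simp add: small_simplex_bound_def)
  fix P :: "(real^'d) set"
  assume P: "P \<subseteq> cbox 0 1 \<and> finite P \<and> card P = n"
  define Q where "Q = reindex -` P"
  have PQ: "P = reindex ` Q" using surj_reindex by (auto simp: Q_def image_vimage_eq)
  have "inj_on reindex X" for X :: "(real^'d ordered_copy) set"
    using inj_reindex by (rule inj_on_subset) simp
  then have card: "card (reindex ` X) = card X" for X :: "(real^'d ordered_copy) set"
    by (rule card_image)
  have "Q \<subseteq> cbox 0 1"
  proof
    fix x assume "x \<in> Q"
    then have "reindex x \<in> cbox 0 1" using P by (auto simp: Q_def)
    then have "0 \<le> reindex x $ Rep_ordered_copy i \<and> reindex x $ Rep_ordered_copy i \<le> 1" for i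
      by (simp add: mem_box_cart)
    then show "x \<in> cbox 0 1" by (simp add: mem_box_cart reindex_nth)
  qed
  moreover have "finite Q" unfolding Q_def using P inj_reindex by (intro finite_vimageI) auto
  moreover have "card Q = n" using P card unfolding PQ by simp
  ultimately obtain T where T: "T \<subseteq> Q" "card T = CARD('d ordered_copy) + 1"
    "measure lebesgue (convex hull T) \<le> \<Delta>"
    using assms unfolding small_simplex_bound_def by blast
  have "finite T" using T(1) \<open>finite Q\<close> finite_subset by blast
  then show "\<exists>S\<subseteq>P. card S = CARD('d) + 1 \<and> measure lebesgue (convex hull S) \<le> \<Delta>"
    using T card measure_reindex_hull[of T] unfolding PQ CARD_ordered_copy
    by (intro exI[of _ "reindex ` T"]) auto
qed

theorem corollary1p3:
  assumes "CARD('d::finite) \<ge> 3"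
  shows "\<exists>C>0. \<forall>n \<ge> CARD('d) + 1.
           simplex_Delta TYPE('d) n \<le> C * real n powr (- ln (real CARD('d)) + 6)"
proof -
  note small_simplices[where 'w = "'d ordered_copy", unfolded CARD_ordered_copy]
  then obtain C where C: "C > 0" and bound: "\<forall>n\<ge>CARD('d) + 1.
      small_simplex_bound TYPE('d ordered_copy) n (C * real n powr (- ln (real CARD('d)) + 6))"
    by (elim exE conjE)
  have "simplex_Delta TYPE('d) n \<le> C * real n powr (- ln (real CARD('d)) + 6)"
    if "n \<ge> CARD('d) + 1" for n
    by (rule simplex_Delta_minimum(2)[OF that small_simplex_bound_ordered_copy[OF bound[rule_format, OF that]]])
  then show ?thesis using C by blast
qed

end
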